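(* Let $\gamma\in\mathbb{R}$, $m>0$, $U$ a smooth function, and let $L:\mathbb{R}\times\mathbb{C}\times\mathbb{C}\times\mathbb{C}\to\mathbb{C}$ be the Lagrangian of order $2$ $$L(t,x,v_1,v_2)=-U(x)-\frac{\gamma}{2}v_1^2+\frac12mv_2^2.$$ The $\mathbb{D}^{1/2}$-fractional embedding of the generalized Euler-Lagrange equation associated to $L$ reduces, on the set of smooth functions, to the equation $$-\frac{dU}{dx}+\gamma\frac{dx}{dt}+m\frac{d^2x}{dt^2}=0.$$
   Context: Left fractional derivative: for $\alpha>0$, $n\in\mathbb{N}$ with $n-1\le\alpha<n$, $\mathbb{D}^{\alpha}x(t)=\frac{1}{\Gamma(n-\alpha)}\frac{d^n}{dt^n}\int_{-\infty}^t(t-s)^{n-\alpha-1}x(s)\,ds$, for functions $x$ on $\mathbb{R}$. On the function spaces considered in the paper (closures of $C_0^{\infty}(I)$, $I$ a bounded open interval, under the norm $(\|x\|_{L^2}^2+\|\mathbb{D}^{\beta}x\|_{L^2}^2)^{1/2}$) one has $\mathbb{D}^{\alpha}\mathbb{D}^{\beta-\alpha}=\mathbb{D}^{\beta}$ for $0<\alpha<\beta$; the paper uses this semi-group property throughout. Integer order $\mathbb{D}^k$ reduces to $\frac{d^k}{dt^k}$ on smooth functions. The generalized Euler-Lagrange equation of a Lagrangian $L(t,x,v_1,v_2)$ of order $2$ is $\frac{\partial L}{\partial x}+\sum_{i=1}^2(-1)^i\left(\frac{d}{dt}\right)^i\left[\frac{\partial L}{\partial v_i}\right]=0$, with partial derivatives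 evaluated at $(t,x,\dot x,\ddot x)$. Its $\mathbb{D}^{\alpha}$-fractional embedding is the equation obtained by replacing $\frac{d}{dt}$ by $\mathbb{D}^{\alpha}$ everywhere: $$\frac{\partial L}{\partial x}(z(t))+\sum_{i=1}^2(-1)^i(\mathbb{D}^{\alpha})^i\left[\frac{\partial L}{\partial v_i}(z(t))\right]=0,\qquad z(t)=(t,x,\mathbb{D}^{\alpha}x,(\mathbb{D}^{\alpha})^2x).$$ *)

theory Defs
  imports "HOL-Analysis.Analysis"
begin

section \<open>Smooth functions of a real variable\<close>

definition ddt :: "(real \<Rightarrow> complex) \<Rightarrow> real \<Rightarrow> complex" where
  "ddt f = (\<lambda>t. vector_derivative f (at t))"

definition everywhere_differentiable :: "(real \<Rightarrow> complex) \<Rightarrow> bool" where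
  "everywhere_differentiable f \<longleftrightarrow> (\<forall>t. f differentiable (at t))"

definition smooth :: "(real \<Rightarrow> complex) \<Rightarrow> bool" where
  "smooth f \<longleftrightarrow> (\<forall>k. everywhere_differentiable ((ddt ^^ k) f))"

text \<open>The space of smooth functions whose support is a compact subset of \<open>I\<close>.\<close>

definition test_functions :: "real set \<Rightarrow> (real \<Rightarrow> complex) set" where
  "test_functions I =
     {\<phi>. smooth \<phi> \<and> compact (closure {t. \<phi> t \<noteq> 0}) \<and> closure {t. \<phi> t \<noteq> 0} \<subseteq> I}"


section \<open>The left fractional derivative\<close>

text \<open>The unique natural number \<open>n\<close> with \<open>n - 1 \<le> \<alpha> < n\<close>, for \<open>\<alpha> \<ge> 0\<close>.\<close>

definition frac_ord :: "real \<Rightarrow> nat" where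
  "frac_ord \<alpha> = nat \<lfloor>\<alpha>\<rfloor> + 1"

definition frac_kernel :: "real \<Rightarrow> (real \<Rightarrow> complex) \<Rightarrow> real \<Rightarrow> real \<Rightarrow> complex" where
  "frac_kernel \<alpha> x t s = ((t - s) powr (real (frac_ord \<alpha>) - \<alpha> - 1)) *\<^sub>R x s"

definition frac_integral :: "real \<Rightarrow> (real \<Rightarrow> complex) \<Rightarrow> real \<Rightarrow> complex" where
  "frac_integral \<alpha> x t = integral {..t} (frac_kernel \<alpha> x t)"

definition frac_deriv :: "real \<Rightarrow> (real \<Rightarrow> complex) \<Rightarrow> real \<Rightarrow> complex" where
  "frac_deriv \<alpha> x t =
     (1 / Gamma (real (frac_ord \<alpha>) - \<alpha>)) *\<^sub>R (ddt ^^ frac_ord \<alpha>) (frac_integral \<alpha> x) t"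

text \<open>
  \<open>frac_deriv\<close> is a total function with an arbitrary value where the integral or one of the
  derivatives does not exist; the following predicate says that it is meaningful on the whole line.
\<close>

definition frac_differentiable :: "real \<Rightarrow> (real \<Rightarrow> complex) \<Rightarrow> bool" where
  "frac_differentiable \<alpha> x \<longleftrightarrow>
     (\<forall>t. frac_kernel \<alpha> x t absolutely_integrable_on {..t}) \<and>
     (\<forall>k < frac_ord \<alpha>. everywhere_differentiable ((ddt ^^ k) (frac_integral \<alpha> x)))"


section \<open>The function spaces\<close>

definition square_integrable :: "(real \<Rightarrow> complex) \<Rightarrow> bool" where
  "square_integrable f \<longleftrightarrow>
     f \<in> borel_measurable lebesgue \<and> integrable lebesgue (\<lambda>t. (cmod (f t))\<^sup>2)"

definition L2_norm :: "(real \<Rightarrow> complex) \<Rightarrow> real" where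
  "L2_norm f = sqrt (\<integral>t. (cmod (f t))\<^sup>2 \<partial>lebesgue)"

definition frac_norm :: "real \<Rightarrow> (real \<Rightarrow> complex) \<Rightarrow> real" where
  "frac_norm \<beta> f = sqrt ((L2_norm f)\<^sup>2 + (L2_norm (frac_deriv \<beta> f))\<^sup>2)"

text \<open>
  The closure of \<open>test_functions I\<close> under \<open>frac_norm \<beta>\<close>, realised inside \<open>L\<^sup>2(\<real>)\<close>: its members are
  the \<open>L\<^sup>2\<close>-limits of those sequences of test functions that are Cauchy for \<open>frac_norm \<beta>\<close>.
  In this form the norm is evaluated on test functions only, and the fractional derivative of
  a general member, which need not exist pointwise, is not needed.
\<close>

definition frac_space :: "real \<Rightarrow> real set \<Rightarrow> (real \<Rightarrow> complex) set" where
  "frac_space \<beta> I =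
     {x. square_integrable x \<and>
         (\<exists>\<phi>. (\<forall>k::nat. \<phi> k \<in> test_functions I) \<and>
              (\<forall>\<epsilon>>0. \<exists>N. \<forall>j\<ge>N. \<forall>k\<ge>N. frac_norm \<beta> (\<lambda>t. \<phi> j t - \<phi> k t) < \<epsilon>) \<and>
              (\<lambda>k. L2_norm (\<lambda>t. \<phi> k t - x t)) \<longlonglongrightarrow> 0)}"


section \<open>Generalized Euler-Lagrange equations of order 2 and their embeddings\<close>

type_synonym lagrangian = "real \<Rightarrow> complex \<Rightarrow> complex \<Rightarrow> complex \<Rightarrow> complex"

text \<open>
  The partial derivatives with respect to the complex variables \<open>x\<close>, \<open>v\<^sub>1\<close>, \<open>v\<^sub>2\<close> at
  \<open>z(t) = (t, x, D x, D\<^sup>2 x)\<close>, for an operator \<open>D\<close> that is \<open>d/dt\<close> for the classical equation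
  and the fractional derivative for its embedding.
\<close>

definition pd_x ::
  "((real \<Rightarrow> complex) \<Rightarrow> real \<Rightarrow> complex) \<Rightarrow> lagrangian \<Rightarrow> (real \<Rightarrow> complex) \<Rightarrow> real \<Rightarrow> complex" where
  "pd_x D L x t = deriv (\<lambda>y. L t y (D x t) (D (D x) t)) (x t)"

definition pd_v1 ::
  "((real \<Rightarrow> complex) \<Rightarrow> real \<Rightarrow> complex) \<Rightarrow> lagrangian \<Rightarrow> (real \<Rightarrow> complex) \<Rightarrow> real \<Rightarrow> complex" where
  "pd_v1 D L x t = deriv (\<lambda>v. L t (x t) v (D (D x) t)) (D x t)"

definition pd_v2 ::
  "((real \<Rightarrow> complex) \<Rightarrow> real \<Rightarrow> complex) \<Rightarrow> lagrangian \<Rightarrow> (real \<Rightarrow> complex) \<Rightarrow> real \<Rightarrow> complex" where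
  "pd_v2 D L x t = deriv (\<lambda>v. L t (x t) (D x t) v) (D (D x) t)"

definition EL_expr ::
  "((real \<Rightarrow> complex) \<Rightarrow> real \<Rightarrow> complex) \<Rightarrow> lagrangian \<Rightarrow> (real \<Rightarrow> complex) \<Rightarrow> real \<Rightarrow> complex" where
  "EL_expr D L x t = pd_x D L x t - D (pd_v1 D L x) t + D (D (pd_v2 D L x)) t"

text \<open>
  Every derivative that occurs in \<open>EL_expr\<close> exists, where \<open>admissible\<close> characterises the domain of \<open>D\<close>.
\<close>

definition EL_defined ::
  "((real \<Rightarrow> complex) \<Rightarrow> bool) \<Rightarrow> ((real \<Rightarrow> complex) \<Rightarrow> real \<Rightarrow> complex) \<Rightarrow>
   lagrangian \<Rightarrow> (real \<Rightarrow> complex) \<Rightarrow> bool" where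
  "EL_defined admissible D L x \<longleftrightarrow>
     admissible x \<and> admissible (D x) \<and>
     (\<forall>t. (\<lambda>y. L t y (D x t) (D (D x) t)) field_differentiable (at (x t)) \<and>
          (\<lambda>v. L t (x t) v (D (D x) t)) field_differentiable (at (D x t)) \<and>
          (\<lambda>v. L t (x t) (D x t) v) field_differentiable (at (D (D x) t))) \<and>
     admissible (pd_v1 D L x) \<and> admissible (pd_v2 D L x) \<and> admissible (D (pd_v2 D L x))"

definition generalized_EL_equation :: "lagrangian \<Rightarrow> (real \<Rightarrow> complex) \<Rightarrow> bool" where
  "generalized_EL_equation L x \<longleftrightarrow>
     EL_defined everywhere_differentiable ddt L x \<and> (\<forall>t. EL_expr ddt L x t = 0)"

definition frac_embedded_EL_equation :: "real \<Rightarrow> lagrangian \<Rightarrow> (real \<Rightarrow> complex) \<Rightarrow> bool" where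
  "frac_embedded_EL_equation \<alpha> L x \<longleftrightarrow>
     EL_defined (frac_differentiable \<alpha>) (frac_deriv \<alpha>) L x \<and>
     (\<forall>t. EL_expr (frac_deriv \<alpha>) L x t = 0)"

definition friction_lagrangian :: "real \<Rightarrow> real \<Rightarrow> (complex \<Rightarrow> complex) \<Rightarrow> lagrangian" where
  "friction_lagrangian \<gamma> m U t x v1 v2 =
     - U x - (complex_of_real \<gamma> / 2) * v1\<^sup>2 + (1 / 2) * complex_of_real m * v2\<^sup>2"

end

theory Submission
  imports Defs
begin

text \<open>
  For \<open>0 \<le> \<alpha> < 1\<close> the fractional derivative is \<open>d/dt\<close> after convolution with the kernel
  \<open>k\<^sub>p(u) = u\<^sup>p\<^sup>-\<^sup>1 / \<Gamma>(p)\<close> on \<open>u > 0\<close>, where \<open>p = 1 - \<alpha>\<close>. Euler's Beta integral says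
  exactly that \<open>k\<^sub>p * k\<^sub>q = k\<^sub>p\<^sub>+\<^sub>q\<close> (\<open>rl_kernel_convolution\<close>), so by Fubini's theorem the
  convolution operators \<open>I\<^sub>p\<close> satisfy \<open>I\<^sub>p I\<^sub>q = I\<^sub>p\<^sub>+\<^sub>q\<close> (\<open>rl_integral_semigroup\<close>). All integrals
  converge because only functions vanishing near \<open>-\<infinity>\<close> are considered: a smooth member of the
  function space is an \<open>L\<^sup>2\<close>-limit of functions supported in \<open>(a, b)\<close>, hence vanishes to the
  left of \<open>a\<close> (\<open>frac_space_vanishes_left\<close>). The operators \<open>I\<^sub>p\<close>
  preserve this one-sided condition, whereas they give a compactly supported function a tail to
  the right.

  The semigroup law also yields the calculus of \<open>I\<^sub>p\<close>. The operator \<open>I\<^sub>1\<close> is the antiderivative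
  that vanishes near \<open>-\<infinity>\<close>, so \<open>y = I\<^sub>1 y'\<close> and \<open>I\<^sub>p y = I\<^sub>p I\<^sub>1 y' = I\<^sub>1 (I\<^sub>p y')\<close>; the
  fundamental theorem of calculus then gives \<open>(I\<^sub>p y)' = I\<^sub>p y'\<close> without differentiating under a
  singular integral (\<open>rl_integral_has_vector_derivative\<close>). Consequently, for \<open>\<alpha> + \<beta> = 1\<close>,
  the composite \<open>D\<^sup>\<alpha> D\<^sup>\<beta>\<close> sends \<open>y\<close> to \<open>I\<^sub>1 y'' = y'\<close> (\<open>frac_deriv_frac_deriv\<close>).

  With \<open>\<alpha> = \<beta> = 1/2\<close> the embedded equation collapses: \<open>\<partial>L/\<partial>v\<^sub>1 = - \<gamma> D x\<close> contributes
  \<open>\<gamma> D (D x) = \<gamma> x'\<close>, and \<open>\<partial>L/\<partial>v\<^sub>2 = m D (D x) = m x'\<close> contributes \<open>m D (D x') = m x''\<close>.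
\<close>

section \<open>The Riemann-Liouville kernels\<close>

text \<open>
  The normalisation by the Gamma function makes the kernels a one-parameter semigroup under
  convolution.
\<close>

definition rl_kernel :: "real \<Rightarrow> real \<Rightarrow> real" where
  "rl_kernel p u = (if 0 < u then u powr (p - 1) / Gamma p else 0)"

lemma rl_kernel_nonneg [simp]: "0 < p \<Longrightarrow> 0 \<le> rl_kernel p u"
  using Gamma_real_pos[of p] by (simp add: rl_kernel_def)

lemma rl_kernel_measurable [measurable]: "rl_kernel p \<in> borel_measurable borel"
  unfolding rl_kernel_def by measurable

lemma rl_kernel_integrable:
  assumes "0 < p"
  shows "integrable lborel (\<lambda>u. indicator {..T} u * rl_kernel p u)"
proof (cases "0 \<le> T")
  case True
  have "(\<lambda>u::real. u powr (p - 1)) integrable_on {0..T}"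
    using integrable_on_powr_from_0[of "p - 1" T] assms True by simp
  then have "(\<lambda>u::real. u powr (p - 1)) absolutely_integrable_on {0..T}"
    by (rule nonnegative_absolutely_integrable_1) simp
  then have "integrable lborel (\<lambda>u. indicator {0..T} u *\<^sub>R u powr (p - 1))"
    unfolding set_integrable_def by (subst (asm) integrable_completion) auto
  then have "integrable lborel (\<lambda>u. (1 / Gamma p) * (indicator {0..T} u *\<^sub>R u powr (p - 1)))"
    by (rule integrable_mult_right)
  moreover have "(\<lambda>u. (1 / Gamma p) * (indicator {0..T} u *\<^sub>R u powr (p - 1)))
      = (\<lambda>u. indicator {..T} u * rl_kernel p u)"
    by (auto simp: rl_kernel_def fun_eq_iff indicator_def)
  ultimately show ?thesis by simp
next
  case False
  then have "(\<lambda>u. indicator {..T} u * rl_kernel p u) = (\<lambda>u. 0)"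
    by (auto simp: rl_kernel_def fun_eq_iff indicator_def)
  then show ?thesis by simp
qed

text \<open>
  After scaling \<open>u = r w\<close> the convolution at \<open>r > 0\<close> is Euler's integral for \<open>B(p, q)\<close>, and
  \<open>\<Gamma>(p) \<Gamma>(q)\<close> cancels.
\<close>

lemma rl_kernel_convolution:
  assumes p: "0 < p" and q: "0 < q"
  shows "integrable lborel (\<lambda>u. rl_kernel p u * rl_kernel q (r - u))"
    and "(\<integral>u. rl_kernel p u * rl_kernel q (r - u) \<partial>lborel) = rl_kernel (p + q) r"
proof -
  let ?f = "\<lambda>u. rl_kernel p u * rl_kernel q (r - u)"
  have "integrable lborel ?f \<and> (\<integral>u. ?f u \<partial>lborel) = rl_kernel (p + q) r"
  proof (cases "0 < r")
    case False
    then have "?f = (\<lambda>u. 0)" by (auto simp: rl_kernel_def fun_eq_iff)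
    then show ?thesis using False by (simp add: rl_kernel_def)
  next
    case r: True
    let ?b = "\<lambda>w::real. w powr (p - 1) * (1 - w) powr (q - 1)"
    define c where "c = r powr (p - 1) * r powr (q - 1) / (Gamma p * Gamma q)"
    have pos: "Gamma p > 0" "Gamma q > 0" using p q by (auto intro: Gamma_real_pos)
    have scaled: "?f (0 + r * w) = c * (indicator {0..1} w *\<^sub>R ?b w)" for w
    proof (cases "0 < w \<and> w < 1")
      case True
      have "r - r * w = r * (1 - w)" by (simp add: algebra_simps)
      moreover have "0 < r * w" "0 < r * (1 - w)" using True r by auto
      ultimately show ?thesis
        using True r unfolding rl_kernel_def c_def
        by (simp add: powr_mult)
    next
      case False
      then have "w \<le> 0 \<or> w = 1 \<or> 1 < w" by linarith
      then show ?thesis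
        using r by (auto simp: rl_kernel_def indicator_def zero_less_mult_iff)
    qed
    have beta: "integrable lborel (\<lambda>w. indicator {0..1} w *\<^sub>R ?b w)"
      using integrable_Beta[OF p q] unfolding set_integrable_def .
    have val: "(\<integral>w. indicator {0..1} w *\<^sub>R ?b w \<partial>lborel) = Beta p q"
      using set_borel_integral_eq_integral(2)[OF integrable_Beta[OF p q]]
        integral_unique[OF has_integral_Beta_real[OF p q]]
      unfolding set_lebesgue_integral_def by simp
    have "integrable lborel (\<lambda>w. ?f (0 + r * w))"
      unfolding scaled using beta by (rule integrable_mult_right)
    then have int: "integrable lborel ?f"
      using lborel_integrable_real_affine_iff[of r ?f 0] r by simp
    have "(\<integral>u. ?f u \<partial>lborel) = \<bar>r\<bar> *\<^sub>R (\<integral>w. ?f (0 + r * w) \<partial>lborel)"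
      by (rule lborel_integral_real_affine) (use r in simp)
    also have "\<dots> = r * (c * Beta p q)"
      unfolding scaled using r val by (subst integral_mult_right_zero) simp
    also have "\<dots> = rl_kernel (p + q) r"
      using pos r unfolding rl_kernel_def c_def Beta_def
      by (simp add: powr_add powr_diff field_simps)
    finally show ?thesis using int by simp
  qed
  then show "integrable lborel ?f" "(\<integral>u. ?f u \<partial>lborel) = rl_kernel (p + q) r" by auto
qed

section \<open>Riemann-Liouville integrals of functions vanishing near minus infinity\<close>

definition rl_integral :: "real \<Rightarrow> (real \<Rightarrow> complex) \<Rightarrow> real \<Rightarrow> complex" where
  "rl_integral p y t = (\<integral>u. rl_kernel p u *\<^sub>R y (t - u) \<partial>lborel)"

definition causal :: "(real \<Rightarrow> complex) \<Rightarrow> bool" where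
  "causal y \<longleftrightarrow> (\<exists>a. \<forall>t<a. y t = 0)"

lemma causal_bounded:
  fixes y :: "real \<Rightarrow> complex"
  assumes "continuous_on UNIV y" and "\<forall>t<a. y t = 0"
  obtains B where "0 \<le> B" "\<And>s. s \<le> T \<Longrightarrow> norm (y s) \<le> B"
proof -
  have "compact (y ` {a..T})"
    by (rule compact_continuous_image[OF continuous_on_subset[OF assms(1)]]) auto
  then obtain B where B: "\<forall>z\<in>y ` {a..T}. norm z \<le> B"
    using compact_imp_bounded bounded_iff by blast
  have "norm (y s) \<le> max B 0" if "s \<le> T" for s
    using B assms(2) that by (cases "s < a") (auto intro: order_trans[of _ B])
  then show ?thesis using that[of "max B 0"] by auto
qed

text \<open>
  A majorant that is uniform in \<open>t \<le> T\<close>, so that it serves both integrability at one point and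
  dominated convergence along a sequence. Only \<open>0 < u \<le> T - a\<close> matters, since the kernel vanishes
  for \<open>u \<le> 0\<close> and \<open>y (t - u)\<close> vanishes for larger \<open>u\<close>.
\<close>

lemma rl_integrand_bound:
  assumes "0 < p" "\<forall>t<a. y t = 0" "0 \<le> B" "\<And>s. s \<le> T \<Longrightarrow> norm (y s) \<le> B" "t \<le> T"
  shows "norm (rl_kernel p u *\<^sub>R y (t - u)) \<le> B * (indicator {..T - a} u * rl_kernel p u)"
proof (cases "0 < u \<and> u \<le> T - a")
  case True
  then have "norm (y (t - u)) \<le> B" using assms by auto
  then have "rl_kernel p u * norm (y (t - u)) \<le> rl_kernel p u * B"
    using assms(1) by (intro mult_left_mono) auto
  then show ?thesis using True assms(1) by (simp add: mult.commute)
next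
  case False
  then have "rl_kernel p u = 0 \<or> t - u < a" using assms(5) by (auto simp: rl_kernel_def)
  then show ?thesis using assms by auto
qed

lemma rl_integrand_integrable:
  assumes "0 < p" and y: "continuous_on UNIV y" "causal y"
  shows "integrable lborel (\<lambda>u. rl_kernel p u *\<^sub>R y (t - u))"
proof -
  obtain a where a: "\<forall>t<a. y t = 0" using y(2) by (auto simp: causal_def)
  obtain B where B: "0 \<le> B" "\<And>s. s \<le> t \<Longrightarrow> norm (y s) \<le> B"
    using causal_bounded[OF y(1) a] by blast
  have [measurable]: "y \<in> borel_measurable borel"
    using y(1) by (rule borel_measurable_continuous_onI)
  show ?thesis
  proof (rule Bochner_Integration.integrable_bound)
    show "integrable lborel (\<lambda>u. B * (indicator {..t - a} u * rl_kernel p u))"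
      by (intro integrable_mult_right rl_kernel_integrable assms)
    show "AE u in lborel. norm (rl_kernel p u *\<^sub>R y (t - u))
        \<le> norm (B * (indicator {..t - a} u * rl_kernel p u))"
      using rl_integrand_bound[OF assms(1) a B order_refl] assms(1) B(1) by (intro AE_I2) simp
  qed measurable
qed

lemma causal_rl_integral:
  assumes "causal y"
  shows "causal (rl_integral p y)"
proof -
  obtain a where a: "\<forall>t<a. y t = 0" using assms by (auto simp: causal_def)
  have "rl_integral p y t = 0" if "t < a" for t
  proof -
    have "(\<lambda>u. rl_kernel p u *\<^sub>R y (t - u)) = (\<lambda>u. 0)"
      using a that by (auto simp: rl_kernel_def)
    then show ?thesis by (simp add: rl_integral_def)
  qed
  then show ?thesis by (auto simp: causal_def)
qed

lemma continuous_rl_integral: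
  assumes p: "0 < p" and y: "continuous_on UNIV y" "causal y"
  shows "continuous_on UNIV (rl_integral p y)"
proof -
  obtain a where a: "\<forall>t<a. y t = 0" using y(2) by (auto simp: causal_def)
  have [measurable]: "y \<in> borel_measurable borel"
    using y(1) by (rule borel_measurable_continuous_onI)
  have "(\<lambda>n. rl_integral p y (X n)) \<longlonglongrightarrow> rl_integral p y t" if X: "X \<longlonglongrightarrow> t" for X t
  proof -
    obtain T where T: "\<And>n. X n \<le> T"
      using convergent_imp_Bseq[OF convergentI[OF X]]
      by (auto simp: Bseq_def abs_le_iff real_norm_def)
    obtain B where B: "0 \<le> B" "\<And>s. s \<le> T \<Longrightarrow> norm (y s) \<le> B"
      using causal_bounded[OF y(1) a] by blast
    show ?thesis
      unfolding rl_integral_def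
    proof (rule integral_dominated_convergence
        [where w = "\<lambda>u. B * (indicator {..T - a} u * rl_kernel p u)"])
      show "integrable lborel (\<lambda>u. B * (indicator {..T - a} u * rl_kernel p u))"
        by (intro integrable_mult_right rl_kernel_integrable p)
      show "AE u in lborel. norm (rl_kernel p u *\<^sub>R y (X n - u))
          \<le> B * (indicator {..T - a} u * rl_kernel p u)" for n
        by (intro AE_I2 rl_integrand_bound p a B T)
      have "(\<lambda>n. y (X n - u)) \<longlonglongrightarrow> y (t - u)" for u
        using y(1) X by (intro isCont_tendsto_compose[where g = y] tendsto_intros)
          (auto simp: continuous_on_eq_continuous_at)
      then show "AE u in lborel. (\<lambda>n. rl_kernel p u *\<^sub>R y (X n - u))
          \<longlonglongrightarrow> rl_kernel p u *\<^sub>R y (t - u)"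
        by (intro AE_I2 tendsto_intros)
    qed measurable
  qed
  then show ?thesis
    by (auto simp: continuous_on_eq_continuous_at continuous_at_sequentially comp_def)
qed

text \<open>
  Shifting the inner variable turns the iterated integral into that of \<open>k\<^sub>p(u) k\<^sub>q(r - u) y(t - r)\<close>;
  integrating over \<open>u\<close> first leaves the convolved kernel. The same computation on norms, the
  kernels being nonnegative, provides the integrability that Fubini's theorem requires.
\<close>

lemma rl_integral_semigroup:
  assumes p: "0 < p" and q: "0 < q" and y: "continuous_on UNIV y" "causal y"
  shows "rl_integral p (rl_integral q y) = rl_integral (p + q) y"
proof
  fix t
  have [measurable]: "y \<in> borel_measurable borel"
    using y(1) by (rule borel_measurable_continuous_onI)
  let ?F = "\<lambda>r u. (rl_kernel p u * rl_kernel q (r - u)) *\<^sub>R y (t - r)"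
  have fub: "integrable (lborel \<Otimes>\<^sub>M lborel) (case_prod ?F)"
  proof (rule lborel_pair.Fubini_integrable)
    show "case_prod ?F \<in> borel_measurable (lborel \<Otimes>\<^sub>M lborel)" by measurable
    have "(\<integral>u. norm (case_prod ?F (r, u)) \<partial>lborel) = norm (rl_kernel (p + q) r *\<^sub>R y (t - r))" for r
      using p q rl_kernel_convolution(2)[OF p q, of r] by simp
    moreover have "integrable lborel (\<lambda>r. norm (rl_kernel (p + q) r *\<^sub>R y (t - r)))"
      using rl_integrand_integrable[of "p + q" y t] p q y by (intro integrable_norm) simp
    ultimately show "integrable lborel (\<lambda>r. \<integral>u. norm (case_prod ?F (r, u)) \<partial>lborel)"
      by (simp only:)
    show "AE r in lborel. integrable lborel (\<lambda>u. case_prod ?F (r, u))"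
      using rl_kernel_convolution(1)[OF p q] by (intro AE_I2) simp
  qed
  have "rl_integral p (rl_integral q y) t
      = (\<integral>u. (\<integral>v. rl_kernel p u *\<^sub>R rl_kernel q v *\<^sub>R y (t - u - v) \<partial>lborel) \<partial>lborel)"
    by (simp add: rl_integral_def del: scaleR_scaleR)
  also have "\<dots> = (\<integral>u. (\<integral>r. ?F r u \<partial>lborel) \<partial>lborel)"
  proof (rule Bochner_Integration.integral_cong[OF refl])
    fix u
    show "(\<integral>v. rl_kernel p u *\<^sub>R rl_kernel q v *\<^sub>R y (t - u - v) \<partial>lborel) = (\<integral>r. ?F r u \<partial>lborel)"
      by (subst lborel_integral_real_affine[of 1 _ "-u"]) (simp_all add: algebra_simps)
  qed
  also have "\<dots> = (\<integral>r. (\<integral>u. ?F r u \<partial>lborel) \<partial>lborel)"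
    by (rule lborel_pair.Fubini_integral[OF fub])
  also have "\<dots> = rl_integral (p + q) y t"
    using rl_kernel_convolution[OF p q] by (simp add: rl_integral_def)
  finally show "rl_integral p (rl_integral q y) t = rl_integral (p + q) y t" .
qed

text \<open>The kernel \<open>k\<^sub>1\<close> is the indicator of the positive half-line.\<close>

lemma rl_integral_one:
  assumes y: "continuous_on UNIV y" and a: "\<forall>t<a. y t = 0"
  shows "rl_integral 1 y t = integral {a..t} y"
proof -
  have set_int: "set_integrable lborel {a..t} y"
    unfolding set_integrable_def
    by (rule borel_integrable_compact) (auto intro: continuous_on_subset[OF y])
  have "rl_integral 1 y t = (\<integral>s. rl_kernel 1 (t - s) *\<^sub>R y s \<partial>lborel)"
    unfolding rl_integral_def
    by (subst lborel_integral_real_affine[of "-1" _ t]) simp_all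
  also have "\<dots> = (\<integral>s. indicator {a..t} s *\<^sub>R y s \<partial>lborel)"
  proof (rule integral_cong_AE)
    have [measurable]: "y \<in> borel_measurable borel"
      using y(1) by (rule borel_measurable_continuous_onI)
    show "(\<lambda>s. rl_kernel 1 (t - s) *\<^sub>R y s) \<in> borel_measurable lborel"
      "(\<lambda>s. indicator {a..t} s *\<^sub>R y s) \<in> borel_measurable lborel" by measurable
    show "AE s in lborel. rl_kernel 1 (t - s) *\<^sub>R y s = indicator {a..t} s *\<^sub>R y s"
      using AE_lborel_singleton[of t]
      by eventually_elim (use a in \<open>force simp: rl_kernel_def indicator_def not_le\<close>)
  qed
  also have "\<dots> = integral {a..t} y"
    using set_borel_integral_eq_integral(2)[OF set_int] by (simp add: set_lebesgue_integral_def)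
  finally show ?thesis .
qed

lemma rl_integral_one_has_vector_derivative:
  assumes y: "continuous_on UNIV y" "causal y"
  shows "(rl_integral 1 y has_vector_derivative y t) (at t)"
proof -
  obtain a0 where a0: "\<forall>t<a0. y t = 0" using y(2) by (auto simp: causal_def)
  \<comment> \<open>The base point is lowered so that \<open>t\<close> is interior to \<open>[a, t + 1]\<close>.\<close>
  define a where "a = min a0 (t - 1)"
  have a: "\<forall>t<a. y t = 0" using a0 by (auto simp: a_def)
  have "((\<lambda>u. integral {a..u} y) has_vector_derivative y t) (at t within {a..t + 1})"
    by (rule integral_has_vector_derivative) (auto intro: continuous_on_subset[OF y(1)] simp: a_def)
  moreover have "at t within {a..t + 1} = at t"
    by (rule at_within_Icc_at) (auto simp: a_def)
  moreover have "rl_integral 1 y = (\<lambda>u. integral {a..u} y)"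
    using rl_integral_one[OF y(1) a] by auto
  ultimately show ?thesis by simp
qed

lemma causal_derivative:
  assumes "\<And>t. (y has_vector_derivative y' t) (at t)" and "causal y"
  shows "causal y'"
proof -
  obtain a where a: "\<forall>t<a. y t = 0" using assms(2) by (auto simp: causal_def)
  have "y' t = 0" if "t < a" for t
  proof -
    have "((\<lambda>_. 0) has_vector_derivative y' t) (at t)"
      by (rule has_vector_derivative_transform_within_open[OF assms(1)[of t], of "{..<a}"])
        (use a that in auto)
    then show ?thesis using vector_derivative_unique_at has_vector_derivative_const by blast
  qed
  then show ?thesis by (auto simp: causal_def)
qed

lemma rl_integral_one_derivative:
  assumes y: "\<And>t. (y has_vector_derivative y' t) (at t)" "continuous_on UNIV y'" "causal y"
  shows "rl_integral 1 y' = y"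
proof
  fix t
  obtain a where a: "\<forall>t<a. y t = 0" using y(3) by (auto simp: causal_def)
  obtain a' where a': "\<forall>t<a'. y' t = 0"
    using causal_derivative[OF y(1,3)] by (auto simp: causal_def)
  \<comment> \<open>Both functions vanish left of \<open>b\<close>, \<open>y b = 0\<close>, and \<open>b \<le> t\<close> as the fundamental theorem requires.\<close>
  define b where "b = min (min a a' - 1) t"
  have "(y' has_integral y t - y b) {b..t}"
    by (rule fundamental_theorem_of_calculus)
      (auto simp: b_def intro: has_vector_derivative_at_within y)
  moreover have "y b = 0" using a by (auto simp: b_def)
  moreover have "\<forall>t<b. y' t = 0" using a' by (auto simp: b_def)
  ultimately show "rl_integral 1 y' t = y t"
    using rl_integral_one[OF y(2), of b t] by (simp add: integral_unique)
qed

text \<open>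
  The semigroup law lets \<open>I\<^sub>p\<close> commute with the antiderivative \<open>I\<^sub>1\<close>, which replaces a
  differentiation under the integral sign.
\<close>

lemma rl_integral_has_vector_derivative:
  assumes p: "0 < p"
    and y: "\<And>t. (y has_vector_derivative y' t) (at t)" "continuous_on UNIV y'" "causal y"
  shows "(rl_integral p y has_vector_derivative rl_integral p y' t) (at t)"
proof -
  have y': "causal y'" using y(1,3) by (rule causal_derivative)
  have "rl_integral p y = rl_integral p (rl_integral 1 y')"
    using rl_integral_one_derivative[OF y] by simp
  also have "\<dots> = rl_integral 1 (rl_integral p y')"
    using p y(2) y' by (simp add: rl_integral_semigroup add.commute)
  finally show ?thesis
    using rl_integral_one_has_vector_derivative[of "rl_integral p y'" t]
      continuous_rl_integral[OF p y(2) y'] causal_rl_integral[OF y'] by simp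
qed

section \<open>Smooth functions vanishing near minus infinity\<close>

lemma smooth_has_vector_derivative:
  assumes "smooth y" shows "(y has_vector_derivative ddt y t) (at t)"
  using assms[unfolded smooth_def, rule_format, of 0]
  by (simp add: everywhere_differentiable_def ddt_def vector_derivative_works)

lemma smooth_ddt: "smooth y \<Longrightarrow> smooth (ddt y)"
  unfolding smooth_def by (metis comp_apply funpow_Suc_right)

lemma smooth_continuous: "smooth y \<Longrightarrow> continuous_on UNIV y"
  using smooth_has_vector_derivative has_vector_derivative_continuous
  by (metis continuous_at_imp_continuous_on)

lemma ddt_eqI: "(\<And>t. (f has_vector_derivative f' t) (at t)) \<Longrightarrow> ddt f = f'"
  by (auto simp: ddt_def fun_eq_iff vector_derivative_at)

definition causal_smooth :: "(real \<Rightarrow> complex) \<Rightarrow> bool" where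
  "causal_smooth y \<longleftrightarrow> smooth y \<and> causal y"

lemma causal_smooth_ddt:
  "causal_smooth y \<Longrightarrow> causal_smooth (ddt y)"
  unfolding causal_smooth_def using smooth_ddt causal_derivative smooth_has_vector_derivative by blast

lemma causal_smooth_rl_derivative:
  assumes "0 < p" "causal_smooth y"
  shows "(rl_integral p y has_vector_derivative rl_integral p (ddt y) t) (at t)"
  using assms rl_integral_has_vector_derivative smooth_has_vector_derivative smooth_ddt smooth_continuous
  unfolding causal_smooth_def by blast

text \<open>
  An operator that commutes with \<open>d/dt\<close> preserves smoothness, because every iterated derivative of
  the image is the image of an iterated derivative.
\<close>

lemma smooth_of_commuting:
  assumes der: "\<And>z t. causal_smooth z \<Longrightarrow> (A z has_vector_derivative A (ddt z) t) (at t)"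
    and y: "causal_smooth y"
  shows "smooth (A y)"
proof -
  have "(ddt ^^ k) (A z) = A ((ddt ^^ k) z) \<and> causal_smooth ((ddt ^^ k) z)"
    if "causal_smooth z" for k z
    using that by (induction k) (auto simp: causal_smooth_ddt intro!: ddt_eqI der)
  then show ?thesis
    using der y unfolding smooth_def everywhere_differentiable_def
    by (metis differentiableI_vector)
qed

lemma causal_smooth_rl_integral:
  "0 < p \<Longrightarrow> causal_smooth y \<Longrightarrow> causal_smooth (rl_integral p y)"
  using smooth_of_commuting[of "rl_integral p" y] causal_smooth_rl_derivative causal_rl_integral
  unfolding causal_smooth_def by blast

lemma causal_smooth_mult_has_vector_derivative:
  "causal_smooth y \<Longrightarrow> ((\<lambda>t. c * y t) has_vector_derivative c * ddt y t) (at t)"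
  unfolding causal_smooth_def
  by (intro has_vector_derivative_mult_right smooth_has_vector_derivative) auto

lemma causal_smooth_mult:
  assumes "causal_smooth y" shows "causal_smooth (\<lambda>t. c * y t)"
  using smooth_of_commuting[of "\<lambda>y t. c * y t" y] assms causal_smooth_mult_has_vector_derivative
  by (force simp: causal_smooth_def causal_def)

section \<open>Fractional derivatives of order below one\<close>

lemma frac_ord_one: "0 \<le> \<alpha> \<Longrightarrow> \<alpha> < 1 \<Longrightarrow> frac_ord \<alpha> = 1"
  by (simp add: frac_ord_def floor_eq_iff)

text \<open>
  The equality holds also at the endpoint \<open>s = t\<close>, where \<open>0 powr z = 0\<close> agrees with the value of
  the Riemann-Liouville kernel at \<open>0\<close>.
\<close>

lemma frac_kernel_eq:
  assumes "0 \<le> \<alpha>" "\<alpha> < 1"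
  shows "indicator {..t} s *\<^sub>R frac_kernel \<alpha> y t s
    = Gamma (1 - \<alpha>) *\<^sub>R (rl_kernel (1 - \<alpha>) (t - s) *\<^sub>R y s)"
proof -
  have "Gamma (1 - \<alpha>) \<noteq> 0"
    using Gamma_real_pos[THEN less_imp_neq, of "1 - \<alpha>"] assms by auto
  then show ?thesis
    using assms by (auto simp: frac_kernel_def frac_ord_one rl_kernel_def indicator_def)
qed

lemma frac_integral_rl:
  assumes \<alpha>: "0 \<le> \<alpha>" "\<alpha> < 1" and y: "continuous_on UNIV y" "causal y"
  shows "frac_kernel \<alpha> y t absolutely_integrable_on {..t}"
    and "frac_integral \<alpha> y t = Gamma (1 - \<alpha>) *\<^sub>R rl_integral (1 - \<alpha>) y t"
proof -
  let ?g = "\<lambda>s. rl_kernel (1 - \<alpha>) (t - s) *\<^sub>R y s"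
  have [measurable]: "y \<in> borel_measurable borel"
    using y(1) by (rule borel_measurable_continuous_onI)
  have "integrable lborel (\<lambda>u. ?g (t + (-1) * u))"
    using rl_integrand_integrable[of "1 - \<alpha>" y t] \<alpha> y by simp
  then have g: "integrable lborel ?g"
    using lborel_integrable_real_affine_iff[of "-1" ?g t] by simp
  then have "integrable lebesgue ?g"
    by (subst integrable_completion) auto
  then show abs: "frac_kernel \<alpha> y t absolutely_integrable_on {..t}"
    unfolding set_integrable_def frac_kernel_eq[OF \<alpha>] by (rule integrable_scaleR_right)
  have "frac_integral \<alpha> y t = (\<integral>s. Gamma (1 - \<alpha>) *\<^sub>R ?g s \<partial>lebesgue)"
    using set_lebesgue_integral_eq_integral(2)[OF abs]
    unfolding set_lebesgue_integral_def frac_kernel_eq[OF \<alpha>] frac_integral_def by simp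
  also have "\<dots> = Gamma (1 - \<alpha>) *\<^sub>R (\<integral>s. ?g s \<partial>lborel)"
    by (simp add: integral_completion del: scaleR_scaleR)
  also have "(\<integral>s. ?g s \<partial>lborel) = rl_integral (1 - \<alpha>) y t"
    unfolding rl_integral_def
    by (subst lborel_integral_real_affine[of "-1" _ t]) simp_all
  finally show "frac_integral \<alpha> y t = Gamma (1 - \<alpha>) *\<^sub>R rl_integral (1 - \<alpha>) y t" .
qed

lemma frac_deriv_rl:
  assumes \<alpha>: "0 \<le> \<alpha>" "\<alpha> < 1" and y: "causal_smooth y"
  shows "frac_deriv \<alpha> y = rl_integral (1 - \<alpha>) (ddt y)"
    and "frac_differentiable \<alpha> y"
proof -
  have cont: "continuous_on UNIV y" "causal y"
    using y smooth_continuous by (auto simp: causal_smooth_def)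
  have G: "Gamma (1 - \<alpha>) \<noteq> 0"
    using Gamma_real_pos[THEN less_imp_neq, of "1 - \<alpha>"] \<alpha> by auto
  have eq: "frac_integral \<alpha> y = (\<lambda>t. Gamma (1 - \<alpha>) *\<^sub>R rl_integral (1 - \<alpha>) y t)"
    using frac_integral_rl(2)[OF \<alpha> cont] by auto
  have der: "(frac_integral \<alpha> y has_vector_derivative
      Gamma (1 - \<alpha>) *\<^sub>R rl_integral (1 - \<alpha>) (ddt y) t) (at t)" for t
    unfolding eq using causal_smooth_rl_derivative[of "1 - \<alpha>" y t] \<alpha> y
      bounded_linear.has_vector_derivative[OF bounded_linear_scaleR_right] by force
  show "frac_deriv \<alpha> y = rl_integral (1 - \<alpha>) (ddt y)"
    using ddt_eqI[OF der] G by (simp add: frac_deriv_def fun_eq_iff frac_ord_one \<alpha>)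
  show "frac_differentiable \<alpha> y"
    unfolding frac_differentiable_def everywhere_differentiable_def
    using frac_integral_rl(1)[OF \<alpha> cont] der by (auto simp: frac_ord_one \<alpha> intro: differentiableI_vector)
qed

lemma causal_smooth_frac_deriv:
  "0 \<le> \<alpha> \<Longrightarrow> \<alpha> < 1 \<Longrightarrow> causal_smooth y \<Longrightarrow> causal_smooth (frac_deriv \<alpha> y)"
  by (simp add: frac_deriv_rl causal_smooth_rl_integral causal_smooth_ddt)

lemma frac_deriv_mult:
  assumes "0 \<le> \<alpha>" "\<alpha> < 1" "causal_smooth y"
  shows "frac_deriv \<alpha> (\<lambda>t. c * y t) = (\<lambda>t. c * frac_deriv \<alpha> y t)"
proof -
  have "ddt (\<lambda>t. c * y t) = (\<lambda>t. c * ddt y t)"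
    using assms(3) by (intro ddt_eqI causal_smooth_mult_has_vector_derivative)
  moreover have "rl_integral p (\<lambda>t. c * ddt y t) = (\<lambda>t. c * rl_integral p (ddt y) t)" for p
    unfolding rl_integral_def fun_eq_iff
    by (simp only: mult_scaleR_right[symmetric] integral_mult_right_zero simp_thms)
  ultimately show ?thesis using assms by (simp add: frac_deriv_rl causal_smooth_mult)
qed

text \<open>
  The composite is \<open>I\<^sub>1\<^sub>-\<^sub>\<alpha> I\<^sub>1\<^sub>-\<^sub>\<beta> y''\<close>, whose total order of integration is \<open>1\<close>.
\<close>

lemma frac_deriv_frac_deriv:
  assumes "0 < \<alpha>" "0 < \<beta>" "\<alpha> + \<beta> = 1" and y: "causal_smooth y"
  shows "frac_deriv \<alpha> (frac_deriv \<beta> y) = ddt y"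
proof -
  have \<alpha>: "0 \<le> \<alpha>" "\<alpha> < 1" and \<beta>: "0 \<le> \<beta>" "\<beta> < 1" using assms by auto
  have y': "causal_smooth (ddt y)" and y'': "causal_smooth (ddt (ddt y))"
    using y by (auto intro: causal_smooth_ddt)
  have "ddt (rl_integral (1 - \<beta>) (ddt y)) = rl_integral (1 - \<beta>) (ddt (ddt y))"
    using \<beta> y' by (intro ddt_eqI causal_smooth_rl_derivative) auto
  then have "frac_deriv \<alpha> (frac_deriv \<beta> y)
      = rl_integral (1 - \<alpha>) (rl_integral (1 - \<beta>) (ddt (ddt y)))"
    using \<alpha> \<beta> y y' by (simp add: frac_deriv_rl causal_smooth_rl_integral)
  also have "\<dots> = rl_integral ((1 - \<alpha>) + (1 - \<beta>)) (ddt (ddt y))"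
    using \<alpha> \<beta> y'' by (intro rl_integral_semigroup) (auto simp: causal_smooth_def smooth_continuous)
  also have "(1 - \<alpha>) + (1 - \<beta>) = 1" using assms by simp
  also have "rl_integral 1 (ddt (ddt y)) = ddt y"
    using y' y'' by (intro rl_integral_one_derivative)
      (auto simp: causal_smooth_def smooth_continuous smooth_has_vector_derivative)
  finally show ?thesis .
qed

section \<open>Supports of the members of the function spaces\<close>

lemma test_function_square_integrable:
  assumes "\<phi> \<in> test_functions I" shows "square_integrable \<phi>"
proof -
  let ?K = "closure {t. \<phi> t \<noteq> 0}"
  have cont: "continuous_on UNIV \<phi>" and K: "compact ?K"
    using assms by (auto simp: test_functions_def smooth_continuous)
  have [measurable]: "\<phi> \<in> borel_measurable borel"
    using cont by (rule borel_measurable_continuous_onI)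
  have "integrable lborel (\<lambda>t. indicator ?K t *\<^sub>R (cmod (\<phi> t))\<^sup>2)"
    using K by (rule borel_integrable_compact) (intro continuous_intros continuous_on_subset[OF cont], simp)
  moreover have "indicator ?K t *\<^sub>R (cmod (\<phi> t))\<^sup>2 = (cmod (\<phi> t))\<^sup>2" for t
    using closure_subset[of "{t. \<phi> t \<noteq> 0}"] by (auto simp: indicator_def)
  ultimately have "integrable lborel (\<lambda>t. (cmod (\<phi> t))\<^sup>2)" by (simp only:)
  then show ?thesis
    unfolding square_integrable_def by (subst integrable_completion) (auto intro: measurable_completion)
qed

text \<open>
  Square integrability of \<open>\<phi> - x\<close> is what makes the \<open>L\<^sup>2\<close> seminorm informative: the integral of a
  function that is not integrable is \<open>0\<close> by convention.
\<close>

lemma square_integrable_diff: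
  assumes "square_integrable f" "square_integrable g"
  shows "square_integrable (\<lambda>t. f t - g t)"
proof -
  have [measurable]: "f \<in> borel_measurable lebesgue" "g \<in> borel_measurable lebesgue"
    using assms by (auto simp: square_integrable_def)
  have "integrable lebesgue (\<lambda>t. (cmod (f t - g t))\<^sup>2)"
  proof (rule Bochner_Integration.integrable_bound)
    show "integrable lebesgue (\<lambda>t. 2 * (cmod (f t))\<^sup>2 + 2 * (cmod (g t))\<^sup>2)"
      using assms by (auto simp: square_integrable_def)
    have "(cmod (z - w))\<^sup>2 \<le> 2 * (cmod z)\<^sup>2 + 2 * (cmod w)\<^sup>2" for z w
    proof -
      have "(cmod (z - w))\<^sup>2 \<le> (cmod z + cmod w)\<^sup>2"
        by (intro power_mono norm_triangle_ineq4) simp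
      also have "\<dots> \<le> 2 * (cmod z)\<^sup>2 + 2 * (cmod w)\<^sup>2"
        using sum_squares_bound[of "cmod z" "cmod w"] by (simp add: power2_sum)
      finally show ?thesis .
    qed
    then show "AE t in lebesgue. norm ((cmod (f t - g t))\<^sup>2)
        \<le> norm (2 * (cmod (f t))\<^sup>2 + 2 * (cmod (g t))\<^sup>2)"
      by (intro AE_I2) simp
  qed measurable
  then show ?thesis by (simp add: square_integrable_def)
qed

text \<open>
  The approximating test functions vanish left of \<open>a\<close>. If \<open>x\<close> did not vanish at some \<open>t < a\<close>, then
  by continuity \<open>|x| \<ge> c > 0\<close> on an interval of length \<open>h\<close> there, and every approximant would
  stay at \<open>L\<^sup>2\<close>-distance at least \<open>c \<surd>h\<close> from \<open>x\<close>.
\<close>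

lemma frac_space_vanishes_left:
  assumes x: "x \<in> frac_space \<beta> {a<..<b}" and cont: "continuous_on UNIV x" and t: "t < a"
  shows "x t = 0"
proof (rule ccontr)
  assume nz: "x t \<noteq> 0"
  define c where "c = cmod (x t) / 2"
  have c: "0 < c" using nz by (simp add: c_def)
  have "((\<lambda>s. cmod (x s)) \<longlongrightarrow> cmod (x t)) (at t)"
    using cont by (intro tendsto_norm) (simp add: continuous_on_eq_continuous_at isCont_def)
  then have "\<forall>\<^sub>F s in at t. c < cmod (x s)"
    by (rule order_tendstoD) (use nz in \<open>simp add: c_def\<close>)
  then obtain d where d: "0 < d" "\<And>s. s \<noteq> t \<Longrightarrow> dist s t < d \<Longrightarrow> c < cmod (x s)"
    unfolding eventually_at by auto
  define h where "h = d / 2"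
  have h: "0 < h" using d by (simp add: h_def)
  have big: "c \<le> cmod (x s)" if "s \<in> {t - h..t}" for s
    using d that by (cases "s = t") (auto simp: h_def c_def dist_real_def intro!: less_imp_le)
  from x obtain \<phi> where \<phi>: "\<And>k::nat. \<phi> k \<in> test_functions {a<..<b}"
    and lim: "(\<lambda>k. L2_norm (\<lambda>t. \<phi> k t - x t)) \<longlonglongrightarrow> 0"
    unfolding frac_space_def by auto
  have "sqrt (c\<^sup>2 * h) \<le> L2_norm (\<lambda>t. \<phi> k t - x t)" for k
  proof -
    have zero: "\<phi> k s = 0" if "s < a" for s
      using \<phi>[of k] closure_subset[of "{t. \<phi> k t \<noteq> 0}"] that
      unfolding test_functions_def by force
    have "c\<^sup>2 * h = (\<integral>s. c\<^sup>2 * indicator {t - h..t} s \<partial>lebesgue)"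
      using h by simp
    also have "\<dots> \<le> (\<integral>s. (cmod (\<phi> k s - x s))\<^sup>2 \<partial>lebesgue)"
    proof (rule integral_mono)
      show "integrable lebesgue (\<lambda>s. c\<^sup>2 * indicator {t - h..t} s)"
        by (intro integrable_mult_right integrable_real_indicator) (auto simp: emeasure_lborel_Icc_eq)
      show "integrable lebesgue (\<lambda>s. (cmod (\<phi> k s - x s))\<^sup>2)"
        using square_integrable_diff[OF test_function_square_integrable[OF \<phi>[of k]], of x] x
        by (simp add: square_integrable_def frac_space_def)
      fix s
      show "c\<^sup>2 * indicator {t - h..t} s \<le> (cmod (\<phi> k s - x s))\<^sup>2"
      proof (cases "s \<in> {t - h..t}")
        case True
        then have "\<phi> k s = 0" using zero t by auto
        then show ?thesis using True big[OF True] c by (simp add: power_mono)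
      qed simp
    qed
    finally show ?thesis unfolding L2_norm_def by simp
  qed
  then have "sqrt (c\<^sup>2 * h) \<le> 0"
    by (intro tendsto_lowerbound[OF lim]) auto
  moreover have "0 < sqrt (c\<^sup>2 * h)" using c h by simp
  ultimately show False by simp
qed

section \<open>The embedded equation of the friction Lagrangian\<close>

theorem theorem7p6:
  fixes \<gamma> m \<beta> a b :: real
    and U :: "complex \<Rightarrow> complex"
    and x :: "real \<Rightarrow> complex"
  assumes "0 < m"
    and "U holomorphic_on UNIV"
    and "0 < \<beta>" and "a < b"
    and "x \<in> frac_space \<beta> {a<..<b}"
    and "smooth x"
  shows "EL_defined (frac_differentiable (1/2)) (frac_deriv (1/2)) (friction_lagrangian \<gamma> m U) x \<and>
    (\<forall>t. EL_expr (frac_deriv (1/2)) (friction_lagrangian \<gamma> m U) x t =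
          - deriv U (x t) + complex_of_real \<gamma> * ddt x t + complex_of_real m * (ddt ^^ 2) x t) \<and>
    (frac_embedded_EL_equation (1/2) (friction_lagrangian \<gamma> m U) x \<longleftrightarrow>
      (\<forall>t. - deriv U (x t) + complex_of_real \<gamma> * ddt x t
            + complex_of_real m * (ddt ^^ 2) x t = 0))"
proof -
  let ?D = "frac_deriv (1/2)" and ?L = "friction_lagrangian \<gamma> m U"
  have x: "causal_smooth x"
    using frac_space_vanishes_left[OF assms(5) smooth_continuous[OF assms(6)]] assms(6)
    by (auto simp: causal_smooth_def causal_def)
  have half: "0 \<le> (1/2::real)" "(1/2::real) < 1" by auto
  have Dx: "causal_smooth (?D x)" using causal_smooth_frac_deriv[OF half x] .
  have DD: "?D (?D y) = ddt y" if "causal_smooth y" for y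
    using that by (intro frac_deriv_frac_deriv) auto
  have x': "causal_smooth (ddt x)" using x by (rule causal_smooth_ddt)
  have U: "(U has_field_derivative deriv U z) (at z)" for z
    using assms(2) by (simp add: holomorphic_derivI)
  have dx: "((\<lambda>y. ?L t y v w) has_field_derivative - deriv U z) (at z)" for t v w z
    unfolding friction_lagrangian_def by (auto intro!: derivative_eq_intros U)
  have dv1: "((\<lambda>v. ?L t y v w) has_field_derivative - \<gamma> * z) (at z)" for t y w and z :: complex
    unfolding friction_lagrangian_def by (auto intro!: derivative_eq_intros)
  have dv2: "((\<lambda>w. ?L t y v w) has_field_derivative m * z) (at z)" for t y v and z :: complex
    unfolding friction_lagrangian_def by (auto intro!: derivative_eq_intros)
  have pd: "pd_x ?D ?L x t = - deriv U (x t)" "pd_v1 ?D ?L x = (\<lambda>t. - \<gamma> * ?D x t)"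
    "pd_v2 ?D ?L x = (\<lambda>t. m * ddt x t)" for t
    unfolding pd_x_def pd_v1_def pd_v2_def
    by (simp_all only: DERIV_imp_deriv[OF dx] DERIV_imp_deriv[OF dv1] DERIV_imp_deriv[OF dv2] DD[OF x])
  note closed = causal_smooth_mult causal_smooth_frac_deriv[OF half]
  have fd: "(\<lambda>y. ?L t y v w) field_differentiable (at y')" "(\<lambda>v. ?L t y v w) field_differentiable (at v')"
    "(\<lambda>w. ?L t y v w) field_differentiable (at w')" for t y v w y' v' w'
    unfolding field_differentiable_def using dx dv1 dv2 by blast+
  have defined: "EL_defined (frac_differentiable (1/2)) ?D ?L x"
    unfolding EL_defined_def pd
    by (intro conjI allI frac_deriv_rl(2)[OF half] closed x x' Dx)
      (rule fd)+
  have expr: "EL_expr ?D ?L x t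
      = - deriv U (x t) + complex_of_real \<gamma> * ddt x t + complex_of_real m * (ddt ^^ 2) x t" for t
    unfolding EL_expr_def pd frac_deriv_mult[OF half Dx] frac_deriv_mult[OF half x']
      frac_deriv_mult[OF half closed(2)[OF x']] DD[OF x] DD[OF x']
    by (simp add: numeral_2_eq_2)
  show ?thesis
    using defined expr by (simp add: frac_embedded_EL_equation_def)
qed

end
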